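(* Let $(A,\mu,\alpha)$ be a Hom-associative algebra and $r\in A^{\otimes 2}$ be a solution of the associative Hom-Yang-Baxter equation (AHYBE) in $A$. Then $r$ is also a solution of the AHYBE in the Hom-associative algebra $A^n=(A,\mu^{(n)},\alpha^{2^n})$ for each integer $n\ge 0$, where $\mu^{(n)}=\alpha^{2^n-1}\circ\mu$.
   Context: Throughout, $\mathbf{k}$ is a fixed field of characteristic $0$; vector spaces, linear maps and tensor products are over $\mathbf{k}$. For a linear self-map $f$, $f^m$ denotes its $m$-fold composition, with $f^0=Id$. A Hom-associative algebra $(A,\mu,\alpha)$ is a $\mathbf{k}$-vector space $A$ with a bilinear map $\mu\colon A^{\otimes 2}\to A$ and a linear map $\alpha\colon A\to A$ such that $\alpha\circ\mu=\mu\circ\alpha^{\otimes 2}$ and $\mu\circ(\alpha\otimes\mu)=\mu\circ(\mu\otimes\alpha)$. In a Hom-associative algebra $(A,\mu,\alpha)$, for $r=\sum u_i\otimes v_i\in A^{\otimes 2}$ set $$A(r)=\sum_{i,j}\mu(u_i,u_j)\otimes\alpha(v_j)\otimes\alpha(v_i)-\sum_{i,j}\alpha(u_i)\otimes\mu(v_i,u_j)\otimes\alpha(v_j)+\sum_{i,j}\alpha(u_j)\otimes\alpha(u_i)\otimes\mu(v_i,v_j)\in A^{\otimes 3}.$$ The element $r$ is a solution of the AHYBE in $A$ if $A(r)=0$ (formed with the multiplication and twisting map of the Hom-associative algebra in question). *)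

theory Defs
  imports Complex_Main "HOL-Library.Poly_Mapping"
begin

text \<open>Vector spaces are types of class \<^class>\<open>ab_group_add\<close> with a scalar multiplication,
  as in \<^locale>\<open>vector_space\<close>.  The tensor product depends on the scalar multiplication (a term),
  so it is not formed as a type; it is the quotient set of the free vector space on pairs, resp.
  triples, of vectors by the subspace that the multilinearity relations span.\<close>

definition free_scale :: "'k::field \<Rightarrow> ('b \<Rightarrow>\<^sub>0 'k) \<Rightarrow> ('b \<Rightarrow>\<^sub>0 'k)" where
  "free_scale c p = Poly_Mapping.map ((*) c) p"

definition tensor2_relations ::
    "('k::field \<Rightarrow> 'a::ab_group_add \<Rightarrow> 'a) \<Rightarrow> ('a \<times> 'a \<Rightarrow>\<^sub>0 'k) set" where
  "tensor2_relations scale =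
     {Poly_Mapping.single (x + x', y) 1 - Poly_Mapping.single (x, y) 1
        - Poly_Mapping.single (x', y) 1 | x x' y. True}
   \<union> {Poly_Mapping.single (x, y + y') 1 - Poly_Mapping.single (x, y) 1
        - Poly_Mapping.single (x, y') 1 | x y y'. True}
   \<union> {Poly_Mapping.single (scale c x, y) 1
        - free_scale c (Poly_Mapping.single (x, y) 1) | c x y. True}
   \<union> {Poly_Mapping.single (x, scale c y) 1
        - free_scale c (Poly_Mapping.single (x, y) 1) | c x y. True}"

definition tensor3_relations ::
    "('k::field \<Rightarrow> 'a::ab_group_add \<Rightarrow> 'a) \<Rightarrow> ('a \<times> 'a \<times> 'a \<Rightarrow>\<^sub>0 'k) set" where
  "tensor3_relations scale =
     {Poly_Mapping.single (x + x', y, z) 1 - Poly_Mapping.single (x, y, z) 1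
        - Poly_Mapping.single (x', y, z) 1 | x x' y z. True}
   \<union> {Poly_Mapping.single (x, y + y', z) 1 - Poly_Mapping.single (x, y, z) 1
        - Poly_Mapping.single (x, y', z) 1 | x y y' z. True}
   \<union> {Poly_Mapping.single (x, y, z + z') 1 - Poly_Mapping.single (x, y, z) 1
        - Poly_Mapping.single (x, y, z') 1 | x y z z'. True}
   \<union> {Poly_Mapping.single (scale c x, y, z) 1
        - free_scale c (Poly_Mapping.single (x, y, z) 1) | c x y z. True}
   \<union> {Poly_Mapping.single (x, scale c y, z) 1
        - free_scale c (Poly_Mapping.single (x, y, z) 1) | c x y z. True}
   \<union> {Poly_Mapping.single (x, y, scale c z) 1
        - free_scale c (Poly_Mapping.single (x, y, z) 1) | c x y z. True}"

definition congruent_mod :: "'b::ab_group_add set \<Rightarrow> ('b \<times> 'b) set" where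
  "congruent_mod N = {(p, q). p - q \<in> N}"

abbreviation tensor2_rel ::
    "('k::field \<Rightarrow> 'a::ab_group_add \<Rightarrow> 'a) \<Rightarrow> (('a \<times> 'a \<Rightarrow>\<^sub>0 'k) \<times> ('a \<times> 'a \<Rightarrow>\<^sub>0 'k)) set" where
  "tensor2_rel scale \<equiv> congruent_mod (module.span free_scale (tensor2_relations scale))"

abbreviation tensor3_rel ::
    "('k::field \<Rightarrow> 'a::ab_group_add \<Rightarrow> 'a)
      \<Rightarrow> (('a \<times> 'a \<times> 'a \<Rightarrow>\<^sub>0 'k) \<times> ('a \<times> 'a \<times> 'a \<Rightarrow>\<^sub>0 'k)) set" where
  "tensor3_rel scale \<equiv> congruent_mod (module.span free_scale (tensor3_relations scale))"

definition tensor_square ::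
    "('k::field \<Rightarrow> 'a::ab_group_add \<Rightarrow> 'a) \<Rightarrow> ('a \<times> 'a \<Rightarrow>\<^sub>0 'k) set set" where
  "tensor_square scale = UNIV // tensor2_rel scale"

text \<open>The canonical projections from the free vector spaces.  They carry the vector space
  structure, so a linear combination of pure tensors is the projection of the corresponding
  formal linear combination.\<close>

definition proj2 ::
    "('k::field \<Rightarrow> 'a::ab_group_add \<Rightarrow> 'a) \<Rightarrow> ('a \<times> 'a \<Rightarrow>\<^sub>0 'k) \<Rightarrow> ('a \<times> 'a \<Rightarrow>\<^sub>0 'k) set" where
  "proj2 scale p = tensor2_rel scale `` {p}"

definition proj3 ::
    "('k::field \<Rightarrow> 'a::ab_group_add \<Rightarrow> 'a) \<Rightarrow> ('a \<times> 'a \<times> 'a \<Rightarrow>\<^sub>0 'k)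
      \<Rightarrow> ('a \<times> 'a \<times> 'a \<Rightarrow>\<^sub>0 'k) set" where
  "proj3 scale p = tensor3_rel scale `` {p}"

definition tensor_sum ::
    "('k::field \<Rightarrow> 'a::ab_group_add \<Rightarrow> 'a) \<Rightarrow> nat \<Rightarrow> (nat \<Rightarrow> 'a) \<Rightarrow> (nat \<Rightarrow> 'a)
      \<Rightarrow> ('a \<times> 'a \<Rightarrow>\<^sub>0 'k) set" where
  "tensor_sum scale m u v = proj2 scale (\<Sum>i<m. Poly_Mapping.single (u i, v i) 1)"

definition AHYB_sum ::
    "('k::field \<Rightarrow> 'a::ab_group_add \<Rightarrow> 'a) \<Rightarrow> ('a \<Rightarrow> 'a \<Rightarrow> 'a) \<Rightarrow> ('a \<Rightarrow> 'a)
      \<Rightarrow> nat \<Rightarrow> (nat \<Rightarrow> 'a) \<Rightarrow> (nat \<Rightarrow> 'a) \<Rightarrow> ('a \<times> 'a \<times> 'a \<Rightarrow>\<^sub>0 'k) set" where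
  "AHYB_sum scale \<mu> \<alpha> m u v = proj3 scale
     ((\<Sum>i<m. \<Sum>j<m. Poly_Mapping.single (\<mu> (u i) (u j), \<alpha> (v j), \<alpha> (v i)) 1)
    - (\<Sum>i<m. \<Sum>j<m. Poly_Mapping.single (\<alpha> (u i), \<mu> (v i) (u j), \<alpha> (v j)) 1)
    + (\<Sum>i<m. \<Sum>j<m. Poly_Mapping.single (\<alpha> (u j), \<alpha> (u i), \<mu> (v i) (v j)) 1))"

text \<open>The element $A(r)$.  That it does not depend on the expression of $r$ as a sum of pure
  tensors, and that every $r$ has such an expression, is proved below in \<open>AHYB_tensor_sum\<close> and
  \<open>tensor_square_eq\<close>.\<close>

definition AHYB ::
    "('k::field \<Rightarrow> 'a::ab_group_add \<Rightarrow> 'a) \<Rightarrow> ('a \<Rightarrow> 'a \<Rightarrow> 'a) \<Rightarrow> ('a \<Rightarrow> 'a)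
      \<Rightarrow> ('a \<times> 'a \<Rightarrow>\<^sub>0 'k) set \<Rightarrow> ('a \<times> 'a \<times> 'a \<Rightarrow>\<^sub>0 'k) set" where
  "AHYB scale \<mu> \<alpha> r =
     (THE t. \<exists>m u v. r = tensor_sum scale m u v \<and> t = AHYB_sum scale \<mu> \<alpha> m u v)"

definition AHYBE_solution ::
    "('k::field \<Rightarrow> 'a::ab_group_add \<Rightarrow> 'a) \<Rightarrow> ('a \<Rightarrow> 'a \<Rightarrow> 'a) \<Rightarrow> ('a \<Rightarrow> 'a)
      \<Rightarrow> ('a \<times> 'a \<Rightarrow>\<^sub>0 'k) set \<Rightarrow> bool" where
  "AHYBE_solution scale \<mu> \<alpha> r \<longleftrightarrow> AHYB scale \<mu> \<alpha> r = proj3 scale 0"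

locale hom_associative_algebra = vector_space scale
  for scale :: "'k::field_char_0 \<Rightarrow> 'a::ab_group_add \<Rightarrow> 'a" +
  fixes \<mu> :: "'a \<Rightarrow> 'a \<Rightarrow> 'a" and \<alpha> :: "'a \<Rightarrow> 'a"
  assumes linear_mult_left: "Vector_Spaces.linear scale scale (\<lambda>x. \<mu> x y)"
    and linear_mult_right: "Vector_Spaces.linear scale scale (\<lambda>y. \<mu> x y)"
    and linear_twist: "Vector_Spaces.linear scale scale \<alpha>"
    and multiplicative: "\<alpha> (\<mu> x y) = \<mu> (\<alpha> x) (\<alpha> y)"
    and hom_associative: "\<mu> (\<alpha> x) (\<mu> y z) = \<mu> (\<mu> x y) (\<alpha> z)"


subsection \<open>Well-definedness\<close>

lemma lookup_free_scale [simp]: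
  "Poly_Mapping.lookup (free_scale c p) x = c * Poly_Mapping.lookup p x"
  unfolding free_scale_def by transfer (auto simp: when_def)

lemma free_scale_single: "free_scale c (Poly_Mapping.single x d) = Poly_Mapping.single x (c * d)"
  by (rule poly_mapping_eqI) (simp add: lookup_single when_def)

global_interpretation free: vector_space "free_scale :: 'k::field \<Rightarrow> ('b \<Rightarrow>\<^sub>0 'k) \<Rightarrow> _"
  by unfold_locales (auto intro!: poly_mapping_eqI simp: lookup_add algebra_simps)

definition free_extend :: "('b \<Rightarrow> ('c \<Rightarrow>\<^sub>0 'k::field)) \<Rightarrow> ('b \<Rightarrow>\<^sub>0 'k) \<Rightarrow> ('c \<Rightarrow>\<^sub>0 'k)" where
  "free_extend f p = (\<Sum>x\<in>Poly_Mapping.keys p. free_scale (Poly_Mapping.lookup p x) (f x))"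

lemma free_extend_superset:
  assumes "finite S" "Poly_Mapping.keys p \<subseteq> S"
  shows "free_extend f p = (\<Sum>x\<in>S. free_scale (Poly_Mapping.lookup p x) (f x))"
  unfolding free_extend_def
  by (rule sum.mono_neutral_left) (use assms in \<open>auto simp: in_keys_iff\<close>)

lemma free_extend_single [simp]: "free_extend f (Poly_Mapping.single x 1) = f x"
  by (simp add: free_extend_def)

lemma linear_free_extend: "Vector_Spaces.linear free_scale free_scale (free_extend (f :: 'b \<Rightarrow> ('c \<Rightarrow>\<^sub>0 'k::field)))"
proof
  fix p q :: "'b \<Rightarrow>\<^sub>0 'k" and c
  let ?S = "Poly_Mapping.keys p \<union> Poly_Mapping.keys q"
  show "free_extend f (p + q) = free_extend f p + free_extend f q"
    using Poly_Mapping.keys_add[of p q]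
    by (simp add: free_extend_superset[of ?S] lookup_add free.scale_left_distrib sum.distrib)
  have "Poly_Mapping.keys (free_scale c p) \<subseteq> Poly_Mapping.keys p"
    by (auto simp: in_keys_iff)
  then show "free_extend f (free_scale c p) = free_scale c (free_extend f p)"
    by (simp add: free_extend_superset[of "Poly_Mapping.keys p"] free.scale_sum_right)
qed

lemma free_extend_diff: "free_extend f (p - q) = free_extend f p - free_extend f q"
  and free_extend_sum: "free_extend f (sum h S) = (\<Sum>x\<in>S. free_extend f (h x))"
proof -
  interpret E: Vector_Spaces.linear free_scale free_scale "free_extend f"
    by (rule linear_free_extend)
  show "free_extend f (p - q) = free_extend f p - free_extend f q"
    "free_extend f (sum h S) = (\<Sum>x\<in>S. free_extend f (h x))"
    by (rule E.diff, rule E.sum)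
qed

lemma poly_mapping_sum_single:
  "(\<Sum>k\<in>Poly_Mapping.keys p. Poly_Mapping.single k (Poly_Mapping.lookup p k)) = p"
  by (rule poly_mapping_eqI)
    (auto simp: lookup_sum lookup_single when_def in_keys_iff sum.delta)

lemma congruent_mod_span_class_eq:
  "congruent_mod (free.span R) `` {p} = congruent_mod (free.span R) `` {q} \<longleftrightarrow> p - q \<in> free.span R"
proof -
  have "equiv UNIV (congruent_mod (free.span R))"
  proof (rule equivI)
    show "refl (congruent_mod (free.span R))"
      by (auto simp: refl_on_def congruent_mod_def free.span_zero)
    show "sym (congruent_mod (free.span R))"
      using free.span_neg by (fastforce simp: sym_def congruent_mod_def)
    show "trans (congruent_mod (free.span R))"
      using free.span_add by (fastforce simp: trans_def congruent_mod_def)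
  qed auto
  from eq_equiv_class_iff[OF this, of p q] show ?thesis
    by (simp add: congruent_mod_def)
qed

lemma proj2_eq_iff:
  "proj2 scale p = proj2 scale q \<longleftrightarrow> p - q \<in> free.span (tensor2_relations scale)"
  by (simp add: proj2_def congruent_mod_span_class_eq)

lemma proj3_eq_iff:
  "proj3 scale p = proj3 scale q \<longleftrightarrow> p - q \<in> free.span (tensor3_relations scale)"
  by (simp add: proj3_def congruent_mod_span_class_eq)

text \<open>Maps on pairs that are bilinear modulo the multilinearity relations of triples, i.e. that
  induce bilinear maps into the tensor cube.\<close>

definition bilinear_mod ::
    "('k::field \<Rightarrow> 'a::ab_group_add \<Rightarrow> 'a) \<Rightarrow> ('a \<times> 'a \<Rightarrow> ('a \<times> 'a \<times> 'a \<Rightarrow>\<^sub>0 'k)) \<Rightarrow> bool" where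
  "bilinear_mod scale f \<longleftrightarrow> (\<forall>r\<in>tensor2_relations scale.
     free_extend f r \<in> free.span (tensor3_relations scale))"

context vector_space
begin

lemma proj2_single_scale:
  "proj2 scale (Poly_Mapping.single (x, y) c + p) = proj2 scale (Poly_Mapping.single (scale c x, y) 1 + p)"
proof -
  have "Poly_Mapping.single (scale c x, y) 1 - free_scale c (Poly_Mapping.single (x, y) 1)
      \<in> free.span (tensor2_relations scale)"
    by (intro free.span_base) (auto simp: tensor2_relations_def)
  from free.span_neg[OF this] show ?thesis
    by (simp add: proj2_eq_iff free_scale_single)
qed

lemma exists_tensor_sum: "\<exists>m u v. proj2 scale p = tensor_sum scale m u v"
proof -
  have "\<exists>m u v. proj2 scale (\<Sum>k\<in>S. Poly_Mapping.single k (Poly_Mapping.lookup p k))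
      = tensor_sum scale m u v" if "finite S" for S
    using that
  proof induction
    case empty
    have "proj2 scale (\<Sum>k\<in>{}. Poly_Mapping.single k (Poly_Mapping.lookup p k))
      = tensor_sum scale 0 (\<lambda>_. 0) (\<lambda>_. 0)"
      by (simp add: tensor_sum_def)
    then show ?case by blast
  next
    case (insert k S)
    define c where "c = Poly_Mapping.lookup p k"
    define q where "q = (\<Sum>k\<in>S. Poly_Mapping.single k (Poly_Mapping.lookup p k))"
    obtain x y where k: "k = (x, y)" by fastforce
    from insert obtain m u v where "proj2 scale q = tensor_sum scale m u v"
      unfolding q_def by blast
    then have *: "q - (\<Sum>i<m. Poly_Mapping.single (u i, v i) 1)
        \<in> free.span (tensor2_relations scale)"
      by (simp add: tensor_sum_def proj2_eq_iff)
    have "proj2 scale (Poly_Mapping.single k c + q)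
        = proj2 scale (Poly_Mapping.single (scale c x, y) 1 + q)"
      unfolding k by (rule proj2_single_scale)
    also have "\<dots> = tensor_sum scale (Suc m) (u(m := scale c x)) (v(m := y))"
      using * by (simp add: tensor_sum_def proj2_eq_iff algebra_simps)
    finally show ?case
      using insert.hyps unfolding q_def c_def by (simp, blast)
  qed
  from this[OF finite_keys[of p]] show ?thesis
    by (simp add: poly_mapping_sum_single)
qed

lemma tensor_square_eq: "tensor_square scale = {tensor_sum scale m u v | m u v. True}"
proof -
  have "tensor_square scale = range (proj2 scale)"
    by (auto simp: tensor_square_def quotient_def proj2_def)
  then show ?thesis
    using exists_tensor_sum by (auto simp: tensor_sum_def)
qed

lemma ball_setcompr3: "(\<forall>r\<in>{F x y z | x y z. True}. P r) \<longleftrightarrow> (\<forall>x y z. P (F x y z))"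
  by blast

lemma bilinear_mod_iff:
  fixes f :: "'b \<times> 'b \<Rightarrow> ('b \<times> 'b \<times> 'b \<Rightarrow>\<^sub>0 'a)"
  shows "bilinear_mod scale f \<longleftrightarrow>
     (\<forall>x x' y. f (x + x', y) - f (x, y) - f (x', y) \<in> free.span (tensor3_relations scale))
   \<and> (\<forall>x y y'. f (x, y + y') - f (x, y) - f (x, y') \<in> free.span (tensor3_relations scale))
   \<and> (\<forall>c x y. f (scale c x, y) - free_scale c (f (x, y)) \<in> free.span (tensor3_relations scale))
   \<and> (\<forall>c x y. f (x, scale c y) - free_scale c (f (x, y)) \<in> free.span (tensor3_relations scale))"
proof -
  interpret E: Vector_Spaces.linear free_scale free_scale "free_extend f"
    by (rule linear_free_extend)
  show ?thesis
    unfolding bilinear_mod_def tensor2_relations_def ball_Un ball_setcompr3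
      E.diff E.scale free_extend_single conj_assoc ..
qed

lemma bilinear_mod_add: "bilinear_mod scale (\<lambda>k. f k + g k)" if "bilinear_mod scale f" "bilinear_mod scale g"
proof -
  have "free_extend (\<lambda>k. f k + g k) p = free_extend f p + free_extend g p" for p
    by (simp add: free_extend_def free.scale_right_distrib sum.distrib)
  with that show ?thesis by (auto simp: bilinear_mod_def intro: free.span_add)
qed

lemma bilinear_mod_diff: "bilinear_mod scale (\<lambda>k. f k - g k)" if "bilinear_mod scale f" "bilinear_mod scale g"
proof -
  have "free_extend (\<lambda>k. f k - g k) p = free_extend f p - free_extend g p" for p
    by (simp add: free_extend_def free.scale_right_diff_distrib sum_subtractf)
  with that show ?thesis by (auto simp: bilinear_mod_def intro: free.span_diff)
qed

lemma bilinear_mod_span: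
  assumes "bilinear_mod scale f" "p \<in> free.span (tensor2_relations scale)"
  shows "free_extend f p \<in> free.span (tensor3_relations scale)"
proof -
  interpret E: Vector_Spaces.linear free_scale free_scale "free_extend f"
    by (rule linear_free_extend)
  show ?thesis
    using assms(2)
  proof (induction rule: free.span_induct)
    case base
    show ?case
      using E.subspace_vimage[OF free.subspace_span] by (simp add: vimage_def)
  next
    case (step r)
    then show ?case using assms(1) by (simp add: bilinear_mod_def)
  qed
qed

lemma tensor3_relations_intros:
  "Poly_Mapping.single (x + w, y, z) 1 - Poly_Mapping.single (x, y, z) 1 - Poly_Mapping.single (w, y, z) 1 \<in> tensor3_relations scale"
  "Poly_Mapping.single (x, y + w, z) 1 - Poly_Mapping.single (x, y, z) 1 - Poly_Mapping.single (x, w, z) 1 \<in> tensor3_relations scale"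
  "Poly_Mapping.single (x, y, z + w) 1 - Poly_Mapping.single (x, y, z) 1 - Poly_Mapping.single (x, y, w) 1 \<in> tensor3_relations scale"
  "Poly_Mapping.single (scale c x, y, z) 1 - free_scale c (Poly_Mapping.single (x, y, z) 1) \<in> tensor3_relations scale"
  "Poly_Mapping.single (x, scale c y, z) 1 - free_scale c (Poly_Mapping.single (x, y, z) 1) \<in> tensor3_relations scale"
  "Poly_Mapping.single (x, y, scale c z) 1 - free_scale c (Poly_Mapping.single (x, y, z) 1) \<in> tensor3_relations scale"
  unfolding tensor3_relations_def by (simp only: Un_iff mem_Collect_eq, metis)+

lemma bilinear_mod_single:
  assumes "Vector_Spaces.linear scale scale F" "Vector_Spaces.linear scale scale G"
  shows "bilinear_mod scale (\<lambda>(x, y). Poly_Mapping.single (F x, G y, z) 1)"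
    and "bilinear_mod scale (\<lambda>(x, y). Poly_Mapping.single (F x, z, G y) 1)"
    and "bilinear_mod scale (\<lambda>(x, y). Poly_Mapping.single (z, F x, G y) 1)"
proof -
  interpret F: Vector_Spaces.linear scale scale F by fact
  interpret G: Vector_Spaces.linear scale scale G by fact
  show "bilinear_mod scale (\<lambda>(x, y). Poly_Mapping.single (F x, G y, z) 1)"
    "bilinear_mod scale (\<lambda>(x, y). Poly_Mapping.single (F x, z, G y) 1)"
    "bilinear_mod scale (\<lambda>(x, y). Poly_Mapping.single (z, F x, G y) 1)"
    unfolding bilinear_mod_iff F.add F.scale G.add G.scale prod.case
    by (intro conjI allI free.span_base tensor3_relations_intros)+
qed

end

context hom_associative_algebra
begin

definition AHYB_term :: "'a \<times> 'a \<Rightarrow> 'a \<times> 'a \<Rightarrow> ('a \<times> 'a \<times> 'a \<Rightarrow>\<^sub>0 'k)" where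
  "AHYB_term = (\<lambda>(a, b) (a', b').
       Poly_Mapping.single (\<mu> a a', \<alpha> b', \<alpha> b) 1
     - Poly_Mapping.single (\<alpha> a, \<mu> b a', \<alpha> b') 1
     + Poly_Mapping.single (\<alpha> a', \<alpha> a, \<mu> b b') 1)"

lemma bilinear_mod_AHYB_term:
  "bilinear_mod scale (\<lambda>k. AHYB_term k l)" "bilinear_mod scale (AHYB_term k)"
proof -
  obtain a b where k: "k = (a, b)" by fastforce
  obtain a' b' where l: "l = (a', b')" by fastforce
  note * = bilinear_mod_add[OF bilinear_mod_diff]
  have "bilinear_mod scale (\<lambda>k. (case k of (a, b) \<Rightarrow> Poly_Mapping.single (\<mu> a a', \<alpha> b', \<alpha> b) 1)
     - (case k of (a, b) \<Rightarrow> Poly_Mapping.single (\<alpha> a, \<mu> b a', \<alpha> b') 1)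
     + (case k of (a, b) \<Rightarrow> Poly_Mapping.single (\<alpha> a', \<alpha> a, \<mu> b b') 1))"
    by (rule *[OF bilinear_mod_single(2)[OF linear_mult_left linear_twist]
          bilinear_mod_single(1)[OF linear_twist linear_mult_left]
          bilinear_mod_single(3)[OF linear_twist linear_mult_left]])
  then show "bilinear_mod scale (\<lambda>k. AHYB_term k l)"
    by (simp add: AHYB_term_def l case_prod_unfold)
  have "bilinear_mod scale (\<lambda>k. (case k of (a', b') \<Rightarrow> Poly_Mapping.single (\<mu> a a', \<alpha> b', \<alpha> b) 1)
     - (case k of (a', b') \<Rightarrow> Poly_Mapping.single (\<alpha> a, \<mu> b a', \<alpha> b') 1)
     + (case k of (a', b') \<Rightarrow> Poly_Mapping.single (\<alpha> a', \<alpha> a, \<mu> b b') 1))"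
    by (rule *[OF bilinear_mod_single(1)[OF linear_mult_right linear_twist]
          bilinear_mod_single(3)[OF linear_mult_right linear_twist]
          bilinear_mod_single(2)[OF linear_twist linear_mult_right]])
  then show "bilinear_mod scale (AHYB_term k)"
    by (simp add: AHYB_term_def k case_prod_unfold)
qed

lemma AHYB_sum_cong:
  assumes "tensor_sum scale m u v = tensor_sum scale m' u' v'"
  shows "AHYB_sum scale \<mu> \<alpha> m u v = AHYB_sum scale \<mu> \<alpha> m' u' v'"
proof -
  define D where "D p q = free_extend (\<lambda>k. free_extend (AHYB_term k) q) p" for p q
  define P where "P m u v = (\<Sum>i<m. Poly_Mapping.single (u i, v i) (1::'k))"
    for m and u v :: "nat \<Rightarrow> 'a"
  have D_diff_left: "D (p - p') q = D p q - D p' q" for p p' q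
    unfolding D_def by (rule free_extend_diff)
  have D_diff_right: "D p (q - q') = D p q - D p q'" for p q q'
    unfolding D_def free_extend_diff free_extend_def[of _ p]
    by (simp add: free.scale_right_diff_distrib sum_subtractf)
  have D_swap: "D p q = free_extend (\<lambda>l. free_extend (\<lambda>k. AHYB_term k l) p) q" for p q
    unfolding D_def free_extend_def free.scale_sum_right
    by (subst sum.swap) (simp add: mult.commute)
  have D_left: "D p q \<in> free.span (tensor3_relations scale)"
    if "p \<in> free.span (tensor2_relations scale)" for p q
    unfolding D_swap free_extend_def[of _ q]
    by (intro free.span_sum free.span_scale bilinear_mod_span bilinear_mod_AHYB_term that)
  have D_right: "D p q \<in> free.span (tensor3_relations scale)"
    if "q \<in> free.span (tensor2_relations scale)" for p q
    unfolding D_def free_extend_def[of _ p]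
    by (intro free.span_sum free.span_scale bilinear_mod_span bilinear_mod_AHYB_term that)
  have AHYB_sum: "AHYB_sum scale \<mu> \<alpha> m u v = proj3 scale (D (P m u v) (P m u v))" for m u v
    unfolding AHYB_sum_def D_def P_def free_extend_sum free_extend_single
    by (simp add: AHYB_term_def sum.distrib sum_subtractf)
  let ?p = "P m u v" and ?q = "P m' u' v'"
  have "?p - ?q \<in> free.span (tensor2_relations scale)"
    using assms by (simp add: tensor_sum_def P_def proj2_eq_iff)
  then have "D (?p - ?q) ?p + D ?q (?p - ?q) \<in> free.span (tensor3_relations scale)"
    by (intro free.span_add D_left D_right)
  then show ?thesis
    by (simp add: AHYB_sum proj3_eq_iff D_diff_left D_diff_right)
qed

theorem AHYB_tensor_sum:
  "AHYB scale \<mu> \<alpha> (tensor_sum scale m u v) = AHYB_sum scale \<mu> \<alpha> m u v"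
  unfolding AHYB_def by (rule the_equality) (blast, metis AHYB_sum_cong)

end

end

theory Submission
  imports Defs
begin

text \<open>For every \<open>k\<close> the element \<open>A(r)\<close> for \<open>(\<alpha>\<^sup>k \<circ> \<mu>, \<alpha>\<^sup>k\<^sup>+\<^sup>1)\<close> is the image of
  \<open>A(r)\<close> for \<open>(\<mu>, \<alpha>)\<close> under the linear map \<open>\<alpha>\<^sup>k \<otimes> \<alpha>\<^sup>k \<otimes> \<alpha>\<^sup>k\<close>, so it vanishes
  when the latter does.  The case \<open>k = 2\<^sup>n - 1\<close> is the claim.\<close>

text \<open>The map \<open>f\<close> \<otimes> \<open>f\<close> \<otimes> \<open>f\<close> on
  representatives: it acts on formal combinations of triples, so it makes sense before any
  compatibility with the tensor relations is known.\<close>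

definition free_map3 :: "('a \<Rightarrow> 'a) \<Rightarrow> ('a \<times> 'a \<times> 'a \<Rightarrow>\<^sub>0 'k::field) \<Rightarrow> ('a \<times> 'a \<times> 'a \<Rightarrow>\<^sub>0 'k)" where
  "free_map3 f = free_extend (\<lambda>(x, y, z). Poly_Mapping.single (f x, f y, f z) 1)"

lemma linear_free_map3:
  "Vector_Spaces.linear free_scale free_scale
    (free_map3 f :: ('a \<times> 'a \<times> 'a \<Rightarrow>\<^sub>0 'k::field) \<Rightarrow> _)"
  unfolding free_map3_def by (rule linear_free_extend)

lemma free_map3_single [simp]:
  "free_map3 f (Poly_Mapping.single (x, y, z) 1) = Poly_Mapping.single (f x, f y, f z) 1"
  by (simp add: free_map3_def)

context vector_space
begin

text \<open>Additivity and homogeneity of \<open>f\<close> turn each multilinearity relation into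
  one of the same kind.\<close>

lemma free_map3_relations:
  assumes "Vector_Spaces.linear scale scale f" and "p \<in> tensor3_relations scale"
  shows "free_map3 f p \<in> tensor3_relations scale"
proof -
  interpret f: Vector_Spaces.linear scale scale f by fact
  interpret E: Vector_Spaces.linear free_scale free_scale
    "free_map3 f :: ('b \<times> 'b \<times> 'b \<Rightarrow>\<^sub>0 'a) \<Rightarrow> _"
    by (rule linear_free_map3)
  show ?thesis
    using assms(2)[unfolded tensor3_relations_def]
    by (elim UnE CollectE exE conjE)
      (simp_all only: E.diff E.scale free_map3_single f.add f.scale tensor3_relations_intros)
qed

text \<open>This makes the induced map on the tensor cube well defined; it is used to send
  representatives of zero to representatives of zero.\<close>

lemma free_map3_span:
  assumes "Vector_Spaces.linear scale scale f" and "p \<in> free.span (tensor3_relations scale)"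
  shows "free_map3 f p \<in> free.span (tensor3_relations scale)"
proof -
  interpret E: Vector_Spaces.linear free_scale free_scale
    "free_map3 f :: ('b \<times> 'b \<times> 'b \<Rightarrow>\<^sub>0 'a) \<Rightarrow> _"
    by (rule linear_free_map3)
  have "free_map3 f p \<in> free.span (free_map3 f ` tensor3_relations scale)"
    using assms(2) by (simp add: E.span_image)
  also have "\<dots> \<subseteq> free.span (tensor3_relations scale)"
    using free_map3_relations[OF assms(1)] by (intro free.span_mono) blast
  finally show ?thesis .
qed

lemma linear_funpow:
  assumes "Vector_Spaces.linear scale scale f"
  shows "Vector_Spaces.linear scale scale (f ^^ k)"
proof (induction k)
  case 0
  show ?case using linear_id by (simp add: id_def)
next
  case (Suc k)
  from Vector_Spaces.linear_compose[OF this assms] show ?case by (simp only: funpow.simps)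
qed

end

context hom_associative_algebra
begin

lemma funpow_multiplicative: "(\<alpha> ^^ k) (\<mu> x y) = \<mu> ((\<alpha> ^^ k) x) ((\<alpha> ^^ k) y)"
  by (induction k) (simp_all add: multiplicative)

text \<open>Besides being half of the claim, this makes \<open>AHYB_tensor_sum\<close> available for
  the twisted structure.\<close>

lemma hom_associative_algebra_funpow:
  "hom_associative_algebra scale (\<lambda>x y. (\<alpha> ^^ k) (\<mu> x y)) (\<alpha> ^^ Suc k)"
proof (intro hom_associative_algebra.intro hom_associative_algebra_axioms.intro vector_space_axioms)
  show "Vector_Spaces.linear scale scale (\<lambda>x. (\<alpha> ^^ k) (\<mu> x y))" for y
    using Vector_Spaces.linear_compose[OF linear_mult_left linear_funpow[OF linear_twist]] by (simp add: o_def)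
  show "Vector_Spaces.linear scale scale (\<lambda>y. (\<alpha> ^^ k) (\<mu> x y))" for x
    using Vector_Spaces.linear_compose[OF linear_mult_right linear_funpow[OF linear_twist]] by (simp add: o_def)
  show "Vector_Spaces.linear scale scale (\<alpha> ^^ Suc k)"
    by (rule linear_funpow[OF linear_twist])
  fix x y z
  show "(\<alpha> ^^ Suc k) ((\<alpha> ^^ k) (\<mu> x y)) = (\<alpha> ^^ k) (\<mu> ((\<alpha> ^^ Suc k) x) ((\<alpha> ^^ Suc k) y))"
    by (simp add: funpow_multiplicative multiplicative funpow_swap1[of \<alpha>])
  \<comment> \<open>Pulling \<open>\<alpha> ^^ k\<close> out of both arguments reduces the identity
    to the image of Hom-associativity of \<mu> under \<open>\<alpha> ^^ k\<close>.\<close>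
  have "\<mu> ((\<alpha> ^^ Suc k) x) ((\<alpha> ^^ k) (\<mu> y z)) = (\<alpha> ^^ k) (\<mu> (\<alpha> x) (\<mu> y z))"
    by (simp add: funpow_multiplicative funpow_swap1[of \<alpha>])
  also have "\<dots> = \<mu> ((\<alpha> ^^ k) (\<mu> x y)) ((\<alpha> ^^ Suc k) z)"
    unfolding hom_associative by (simp add: funpow_multiplicative funpow_swap1[of \<alpha>])
  finally show "(\<alpha> ^^ k) (\<mu> ((\<alpha> ^^ Suc k) x) ((\<alpha> ^^ k) (\<mu> y z)))
      = (\<alpha> ^^ k) (\<mu> ((\<alpha> ^^ k) (\<mu> x y)) ((\<alpha> ^^ Suc k) z))"
    by simp
qed

lemma AHYBE_solution_funpow:
  assumes "r \<in> tensor_square scale" and "AHYBE_solution scale \<mu> \<alpha> r"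
  shows "AHYBE_solution scale (\<lambda>x y. (\<alpha> ^^ k) (\<mu> x y)) (\<alpha> ^^ Suc k) r"
proof -
  interpret B: hom_associative_algebra scale "\<lambda>x y. (\<alpha> ^^ k) (\<mu> x y)" "\<alpha> ^^ Suc k"
    by (rule hom_associative_algebra_funpow)
  interpret E: Vector_Spaces.linear free_scale free_scale
    "free_map3 (\<alpha> ^^ k) :: ('a \<times> 'a \<times> 'a \<Rightarrow>\<^sub>0 'k) \<Rightarrow> _"
    by (rule linear_free_map3)
  obtain m u v where r: "r = tensor_sum scale m u v"
    using assms(1) by (auto simp: tensor_square_eq)
  have "AHYB_sum scale \<mu> \<alpha> m u v = proj3 scale 0"
    using assms(2) by (simp add: AHYBE_solution_def r AHYB_tensor_sum)
  \<comment> \<open>The same \<open>u\<close> and \<open>v\<close> express \<open>r\<close> for both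
    structures, so the representatives match term by term: \<open>\<alpha> ^^ k\<close> takes a
    factor \<mu>(a, b) to the twisted product and a factor \<alpha>(a) to
    \<open>(\<alpha> ^^ Suc k) a\<close>.\<close>
  then have "AHYB_sum scale (\<lambda>x y. (\<alpha> ^^ k) (\<mu> x y)) (\<alpha> ^^ Suc k) m u v = proj3 scale 0"
    using free_map3_span[OF linear_funpow[OF linear_twist, of k]]
    unfolding AHYB_sum_def proj3_eq_iff diff_zero
    by (fastforce simp only: E.add E.diff E.sum free_map3_single funpow_swap1[of \<alpha>] funpow.simps o_apply)
  then show ?thesis
    unfolding AHYBE_solution_def r B.AHYB_tensor_sum .
qed

end

theorem theorem5p5:
  fixes scale :: "'k::field_char_0 \<Rightarrow> 'a::ab_group_add \<Rightarrow> 'a"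
    and \<mu> :: "'a \<Rightarrow> 'a \<Rightarrow> 'a" and \<alpha> :: "'a \<Rightarrow> 'a"
    and r :: "('a \<times> 'a \<Rightarrow>\<^sub>0 'k) set" and n :: nat
  assumes "hom_associative_algebra scale \<mu> \<alpha>"
    and "r \<in> tensor_square scale"
    and "AHYBE_solution scale \<mu> \<alpha> r"
  shows "hom_associative_algebra scale (\<lambda>x y. (\<alpha> ^^ (2 ^ n - 1)) (\<mu> x y)) (\<alpha> ^^ (2 ^ n))
    \<and> AHYBE_solution scale (\<lambda>x y. (\<alpha> ^^ (2 ^ n - 1)) (\<mu> x y)) (\<alpha> ^^ (2 ^ n)) r"
proof -
  interpret hom_associative_algebra scale \<mu> \<alpha> by fact
  \<comment> \<open>The truncated subtraction is exact because \<open>2 ^ n\<close> is at least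
    1.\<close>
  have "Suc (2 ^ n - 1) = 2 ^ n" by simp
  then show ?thesis
    using hom_associative_algebra_funpow[of "2 ^ n - 1"]
      AHYBE_solution_funpow[OF assms(2,3), of "2 ^ n - 1"] by metis
qed

end
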